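(* Let $d\ge1$ and let $\mathcal{P}_{\mathbb{T}}^d$ be the family of tropical polytopes in $\mathbb{T}^d$. The tropical barycentric volume $\mathrm{tbvol}$ has the following properties. (i) (Monotonicity) For all $P,Q\in\mathcal{P}_{\mathbb{T}}^d$ with $P\subseteq Q$, $\mathrm{tbvol}(P)\le\mathrm{tbvol}(Q)$. (ii) (Valuation) $\mathrm{tbvol}(P)\oplus\mathrm{tbvol}(Q)=\mathrm{tbvol}(P\cup Q)\oplus\mathrm{tbvol}(P\cap Q)$ for all $P,Q\in\mathcal{P}_{\mathbb{T}}^d$ such that $P\cup Q,\,P\cap Q\in\mathcal{P}_{\mathbb{T}}^d$. (iii) (Rotation invariance) For every $M\in\mathcal{R}_d$ and $P\in\mathcal{P}_{\mathbb{T}}^d$, $\mathrm{tbvol}(M\odot P)=\mathrm{tbvol}(P)$. (iv) (Homogeneity) For every $\lambda\in\mathbb{T}$ and $P\in\mathcal{P}_{\mathbb{T}}^d$, $\mathrm{tbvol}(\lambda\odot P)=\lambda^{\odot d}\odot\mathrm{tbvol}(P)$. (v) (Non-singularity) For $P\in\mathcal{P}_{\mathbb{T}}^d$, $\mathrm{tbvol}(P)=-\infty$ if and only if $\mathrm{Tr}_d(P)=\emptyset$.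
   Context: $\mathbb{T}=\mathbb{R}\cup\{-\infty\}$ with $x\oplus y=\max(x,y)$, $x\odot y=x+y$. For $V\subseteq\mathbb{T}^d$, $\mathrm{tconv}(V)=\{\bigoplus_{j=1}^n\lambda_j\odot v_j:\lambda_j\in\mathbb{T},\ \bigoplus_j\lambda_j=0,\ v_j\in V\}$. A tropical polytope is $\mathrm{tconv}(V)$ for a finite set $V$; its vertices are the elements of its unique minimal generating set. Covector decomposition: let $v_1,\dots,v_n$ be the vertices of $P$, $v_j=(v_{1j},\dots,v_{dj})$, and put $v_{0j}=0$, $x_0=0$. For $G\subseteq\{0,\dots,d\}\times[n]$ let $C_G=\{x\in\mathbb{T}^d: v_{kj}+x_i\le v_{ij}+x_k\text{ for all }(i,j)\in G,\ k\in\{0,\dots,d\}\}$. The closed cells of the covector decomposition of $P$ are the nonempty $C_G$ for which every $i\in\{0,\dots,d\}$ occurs in some $(i,j)\in G$ and every $j\in[n]$ occurs in some $(i,j)\in G$ with $v_{ij}\ne-\infty$. Their union is $P$, and their images under $x\mapsto(b^{x_1},\dots,b^{x_d})$ ($b>1$, $b^{-\infty}=0$) are convex polytopes forming a polyhedral complex; the dimension of a cell is the dimension of its image. The $d$-trunk $\mathrm{Tr}_d(P)$ is the union of all closed cells of dimension $d$. Tropical barycentric volume: $\mathrm{tbvol}(P)=\max_{x\in\mathrm{Tr}_d(P)}(x_1+\dots+x_d)$, with $\max\emptyset=-\infty$. $\lambda\odot P=\{(\lambda+x_1,\dots,\lambda+x_d):x\in P\}$ and $\lambda^{\odot d}=\lambda\odot\cdots\odot\lambda$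 ($d$ times). $\mathcal{R}_d$ is the set of matrices $\mathrm{diag}(z_1,\dots,z_d)\odot\Sigma$ with $z\in\mathbb{T}^d$, $z_1+\dots+z_d=0$, $\Sigma$ a tropical permutation matrix (tropical diagonal matrices have $-\infty$ off the diagonal; tropical permutation matrices have entries $0$ and $-\infty$ in place of $1$ and $0$); $M\odot P$ is the image of $P$ under the tropical matrix-vector product. *)

theory Defs
  imports "HOL-Analysis.Analysis"
begin

text \<open>
  The tropical semiring is the set of extended reals different from \<open>\<infinity>\<close>, with \<open>max\<close> as
  addition and \<open>+\<close> as multiplication. A tropical sum over a finite index set is written as a
  supremum in \<^typ>\<open>ereal\<close>; over the empty set this is \<open>-\<infinity>\<close>, the neutral element of \<open>max\<close>.
\<close>

definition trop :: "ereal set" where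
  "trop = {t. t \<noteq> \<infinity>}"

definition tspace :: "(ereal ^ 'd::finite) set" where
  "tspace = {x. \<forall>i. x $ i \<in> trop}"

definition tpow :: "ereal \<Rightarrow> nat \<Rightarrow> ereal" where
  "tpow l n = ((\<lambda>t. l + t) ^^ n) 0"

definition tscale :: "ereal \<Rightarrow> ereal ^ 'd::finite \<Rightarrow> ereal ^ 'd" where
  "tscale l x = (\<chi> i. l + x $ i)"

definition tconv :: "(ereal ^ 'd::finite) set \<Rightarrow> (ereal ^ 'd) set" where
  "tconv V = {(\<chi> i. SUP j\<in>{1..n}. tscale (l j) (v j) $ i) | (n::nat) l v.
     (\<forall>j\<in>{1..n}. l j \<in> trop \<and> v j \<in> V) \<and> (SUP j\<in>{1..n}. l j) = 0}"

definition trop_polytopes :: "(ereal ^ 'd::finite) set set" where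
  "trop_polytopes = {tconv V | V. finite V \<and> V \<subseteq> tspace}"

definition min_generating :: "(ereal ^ 'd::finite) set \<Rightarrow> (ereal ^ 'd) set \<Rightarrow> bool" where
  "min_generating V P \<longleftrightarrow> V \<subseteq> tspace \<and> tconv V = P \<and> (\<forall>W. W \<subset> V \<longrightarrow> tconv W \<noteq> P)"

definition tvertices :: "(ereal ^ 'd::finite) set \<Rightarrow> (ereal ^ 'd) set" where
  "tvertices P = (THE V. min_generating V P)"

text \<open>
  The index set \<open>{0,\<dots>,d}\<close> is \<open>'d option\<close>, with \<open>None\<close> in the role of \<open>0\<close>. In a covector
  \<open>G\<close> the vertices serve as their own indices.
\<close>

definition hcoord :: "ereal ^ 'd::finite \<Rightarrow> 'd option \<Rightarrow> ereal" where
  "hcoord x i = (case i of None \<Rightarrow> 0 | Some k \<Rightarrow> x $ k)"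

definition covector_set :: "('d::finite option \<times> (ereal ^ 'd)) set \<Rightarrow> (ereal ^ 'd) set" where
  "covector_set G = {x \<in> tspace. \<forall>(i, v) \<in> G. \<forall>k.
     hcoord v k + hcoord x i \<le> hcoord v i + hcoord x k}"

definition closed_cells :: "(ereal ^ 'd::finite) set \<Rightarrow> (ereal ^ 'd) set set" where
  "closed_cells P = {covector_set G | G. G \<subseteq> UNIV \<times> tvertices P \<and> covector_set G \<noteq> {} \<and>
     (\<forall>i. \<exists>v. (i, v) \<in> G) \<and>
     (\<forall>v\<in>tvertices P. \<exists>i. (i, v) \<in> G \<and> hcoord v i \<noteq> -\<infinity>)}"

definition texp :: "real \<Rightarrow> ereal ^ 'd::finite \<Rightarrow> real ^ 'd" where
  "texp b x = (\<chi> i. if x $ i = -\<infinity> then 0 else b powr real_of_ereal (x $ i))"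

text \<open>
  The base \<open>b > 1\<close> only enters through the dimension of the cells. It is kept as a parameter
  rather than being fixed to some particular value.
\<close>

definition trunk :: "real \<Rightarrow> (ereal ^ 'd::finite) set \<Rightarrow> (ereal ^ 'd) set" where
  "trunk b P = \<Union>{C \<in> closed_cells P. aff_dim (texp b ` C) = int CARD('d)}"

definition tbvol :: "real \<Rightarrow> (ereal ^ 'd::finite) set \<Rightarrow> ereal" where
  "tbvol b P = (if trunk b P = {} then -\<infinity>
     else (GREATEST s. s \<in> (\<lambda>x. \<Sum>i\<in>UNIV. x $ i) ` trunk b P))"

definition tmat_mult :: "ereal ^ 'd ^ 'd::finite \<Rightarrow> ereal ^ 'd ^ 'd \<Rightarrow> ereal ^ 'd ^ 'd" where
  "tmat_mult A B = (\<chi> i j. SUP k. A $ i $ k + B $ k $ j)"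

definition tmat_vec :: "ereal ^ 'd ^ 'd::finite \<Rightarrow> ereal ^ 'd \<Rightarrow> ereal ^ 'd" where
  "tmat_vec A x = (\<chi> i. SUP k. A $ i $ k + x $ k)"

definition tdiag :: "ereal ^ 'd::finite \<Rightarrow> ereal ^ 'd ^ 'd" where
  "tdiag z = (\<chi> i j. if i = j then z $ i else -\<infinity>)"

definition tperm :: "('d::finite \<Rightarrow> 'd) \<Rightarrow> ereal ^ 'd ^ 'd" where
  "tperm \<pi> = (\<chi> i j. if j = \<pi> i then 0 else -\<infinity>)"

definition trop_rotations :: "(ereal ^ 'd ^ 'd::finite) set" where
  "trop_rotations = {tmat_mult (tdiag z) (tperm \<pi>) | z \<pi>.
     z \<in> tspace \<and> (\<Sum>i\<in>UNIV. z $ i) = 0 \<and> bij \<pi>}"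

end

theory Submission
  imports Defs
begin

text \<open>
  In exponential coordinates the closed cells are finitely many closed convex sets with union
  \<open>texp b ` P\<close>. A closed convex set is the closure of its interior if it has full dimension and has
  empty interior otherwise, and \<open>closure \<circ> interior\<close> commutes with finite unions of closed sets.
  Hence \<open>texp b ` trunk b P\<close> is the closure of the interior of \<open>texp b ` P\<close>, a description free of
  vertices and cells that is monotone, additive on unions and equivariant under the linear maps
  induced by rotations and finite scalings. Being compact, the trunk attains the supremum of the
  coordinate sum, whose exponential is the product of the coordinates.
\<close>

subsection \<open>Closures of interiors\<close>

text \<open>A point of \<open>interior (A \<union> B)\<close> outside both closures has an open
  neighbourhood \<open>U\<close> inside \<open>A \<union> B\<close> that avoids both interiors. As
  \<open>A\<close> is closed, \<open>U - A\<close> is an open part of \<open>B\<close>, hence empty;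
  then \<open>U\<close> is an open subset of \<open>A\<close>, which is impossible.\<close>

lemma closure_interior_Un:
  assumes "closed A" "closed B"
  shows "closure (interior (A \<union> B)) = closure (interior A) \<union> closure (interior B)"
proof
  have "interior (A \<union> B) \<subseteq> closure (interior A) \<union> closure (interior B)"
  proof
    fix x assume x: "x \<in> interior (A \<union> B)"
    show "x \<in> closure (interior A) \<union> closure (interior B)"
    proof (rule ccontr)
      define U where "U = interior (A \<union> B) - closure (interior A) - closure (interior B)"
      assume "x \<notin> closure (interior A) \<union> closure (interior B)"
      then have xU: "x \<in> U" using x by (auto simp: U_def)
      have oU: "open U" by (auto simp: U_def)
      have UAB: "U \<subseteq> A \<union> B" using interior_subset by (auto simp: U_def)
      have "U - A \<subseteq> interior B"
        by (rule interior_maximal) (use UAB oU assms in auto)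
      then have "U \<subseteq> A" using closure_subset by (fastforce simp: U_def)
      then have "U \<subseteq> interior A" using oU by (rule interior_maximal)
      then show False using xU closure_subset by (fastforce simp: U_def)
    qed
  qed
  then show "closure (interior (A \<union> B)) \<subseteq> closure (interior A) \<union> closure (interior B)"
    by (intro closure_minimal) auto
  show "closure (interior A) \<union> closure (interior B) \<subseteq> closure (interior (A \<union> B))"
    by (simp add: closure_mono interior_mono)
qed

lemma closure_interior_Union:
  assumes "finite F" "\<And>C. C \<in> F \<Longrightarrow> closed C"
  shows "closure (interior (\<Union>F)) = (\<Union>C\<in>F. closure (interior C))"
  using assms by (induction F) (simp_all add: closure_interior_Un closed_Union)

text \<open>A convex set without interior lies in a hyperplane, so its dimension is too small. This
  trades the dimension condition in \<open>trunk\<close> for a topological one.\<close>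

lemma closure_interior_convex:
  fixes S :: "'a::euclidean_space set"
  assumes "closed S" "convex S"
  shows "closure (interior S) = (if aff_dim S = int DIM('a) then S else {})"
proof (cases "interior S = {}")
  case True
  then obtain a r where "a \<noteq> 0" "S \<subseteq> {x. a \<bullet> x = r}"
    using empty_interior_subset_hyperplane[OF assms(2)] by blast
  then have "aff_dim S \<le> int DIM('a) - 1"
    using aff_dim_subset[of S "{x. a \<bullet> x = r}"] by simp
  then show ?thesis using True by simp
next
  case False
  then show ?thesis
    using assms aff_dim_nonempty_interior[of S] convex_closure_interior[of S] by simp
qed

subsection \<open>Tropical convex hulls and vertices\<close>

lemma hcoord_simps [simp]:
  "hcoord x None = 0" "hcoord x (Some k) = x $ k"
  by (simp_all add: hcoord_def)

lemma hcoord_neq_PInf: "x \<in> tspace \<Longrightarrow> hcoord x i \<noteq> \<infinity>"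
  by (cases i) (auto simp: tspace_def trop_def)

lemma ereal_eq_SUP_finite:
  fixes f :: "'a \<Rightarrow> ereal"
  assumes "finite I" "I \<noteq> {}"
  shows "s = (SUP j\<in>I. f j) \<longleftrightarrow> (\<forall>j\<in>I. f j \<le> s) \<and> (\<exists>j\<in>I. f j = s)"
proof -
  have "(SUP j\<in>I. f j) = Max (f ` I)"
    using assms by (simp add: Max_Sup)
  moreover have "s = Max (f ` I) \<longleftrightarrow> (\<forall>j\<in>I. f j \<le> s) \<and> (\<exists>j\<in>I. f j = s)"
    using assms by (auto simp: eq_commute[of s] Max_eq_iff)
  ultimately show ?thesis by simp
qed

text \<open>
  Residuation: for every coordinate of \<open>x\<close> some multiple of a generator lies below \<open>x\<close> and touches
  it there. Touching in the coordinate \<open>None\<close> encodes the normalisation \<open>max l = 0\<close>.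
\<close>

lemma mem_tconv_iff:
  "x \<in> tconv V \<longleftrightarrow> (\<forall>k. \<exists>v\<in>V. \<exists>l. l \<noteq> \<infinity> \<and>
     (\<forall>i. l + hcoord v i \<le> hcoord x i) \<and> l + hcoord v k = hcoord x k)"
    (is "_ \<longleftrightarrow> ?R")
proof
  assume "x \<in> tconv V"
  then obtain n :: nat and l v where x: "x = (\<chi> i. SUP j\<in>{1..n}. tscale (l j) (v j) $ i)"
    and lv: "\<forall>j\<in>{1..n}. l j \<in> trop \<and> v j \<in> V" and l0: "(SUP j\<in>{1..n}. l j) = 0"
    by (auto simp: tconv_def)
  \<comment> \<open>For \<open>n = 0\<close> the supremum would be \<open>-\<infinity>\<close>, so
    the normalisation \<open>l0\<close> forces at least one generator.\<close>
  have ne: "{1..n} \<noteq> {}" using l0 by (auto simp: bot_ereal_def simp del: atLeastatMost_empty_iff atLeastatMost_empty_iff2)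
  have h: "hcoord x i = (SUP j\<in>{1..n}. l j + hcoord (v j) i)" for i
    using l0 by (cases i) (simp_all add: x tscale_def)
  have "(\<forall>j\<in>{1..n}. l j + hcoord (v j) i \<le> hcoord x i) \<and> (\<exists>j\<in>{1..n}. l j + hcoord (v j) i = hcoord x i)"
    for i using ereal_eq_SUP_finite[THEN iffD1, OF finite_atLeastAtMost ne h[of i]] .
  then show ?R using lv by (metis mem_Collect_eq trop_def)
next
  assume ?R
  then obtain w m where wm: "\<And>k. w k \<in> V" "\<And>k. m k \<noteq> \<infinity>"
      "\<And>k i. m k + hcoord (w k) i \<le> hcoord x i" "\<And>k. m k + hcoord (w k) k = hcoord x k"
    by metis
  \<comment> \<open>One touching generator per homogeneous coordinate suffices; \<open>f\<close>
    enumerates these coordinates, because \<open>tconv\<close> indexes its generators by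
    \<open>{1..n}\<close>.\<close>
  obtain f where f: "bij_betw f {1..card (UNIV :: 'a option set)} (UNIV :: 'a option set)"
    using ex_bij_betw_nat_finite_1[of "UNIV :: 'a option set"] by auto
  define n where "n = card (UNIV :: 'a option set)"
  have f: "f ` {1..n} = UNIV" using f by (simp add: n_def bij_betw_def)
  have S: "(SUP j\<in>{1..n}. m (f j) + hcoord (w (f j)) i) = hcoord x i" for i
  proof -
    have "(SUP k\<in>f ` {1..n}. m k + hcoord (w k) i) = hcoord x i"
      unfolding f using wm by (subst eq_commute, subst ereal_eq_SUP_finite) (auto intro: exI[of _ i])
    then show ?thesis by (simp add: image_comp o_def)
  qed
  show "x \<in> tconv V"
    unfolding tconv_def
  proof (intro CollectI exI conjI)
    show "x = (\<chi> i. SUP j\<in>{1..n}. tscale (m (f j)) (w (f j)) $ i)"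
      using S[of "Some _"] by (simp add: vec_eq_iff tscale_def)
    show "\<forall>j\<in>{1..n}. m (f j) \<in> trop \<and> w (f j) \<in> V"
      using wm by (simp add: trop_def)
    show "(SUP j\<in>{1..n}. m (f j)) = 0"
      using S[of None] by simp
  qed
qed

lemma tconvE:
  assumes "x \<in> tconv V"
  obtains v l where "v \<in> V" "l \<noteq> \<infinity>" "\<And>i. l + hcoord v i \<le> hcoord x i"
    "l + hcoord v k = hcoord x k"
  using assms unfolding mem_tconv_iff by meson

lemma tconv_mono: "V \<subseteq> W \<Longrightarrow> tconv V \<subseteq> tconv W"
  unfolding mem_tconv_iff subset_iff by meson

lemma subset_tconv: "V \<subseteq> tconv V"
proof
  fix v assume "v \<in> V"
  then show "v \<in> tconv V"
    unfolding mem_tconv_iff by (intro allI bexI[of _ v] exI[of _ 0]) auto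
qed

text \<open>Touching composes: if a multiple of \<open>p\<close> touches \<open>x\<close> and a
  multiple of \<open>v\<close> touches \<open>p\<close> in coordinate \<open>k\<close>, the sum of
  the two scalars makes \<open>v\<close> touch \<open>x\<close> there.\<close>

lemma tconv_trans:
  assumes "W \<subseteq> tconv V" shows "tconv W \<subseteq> tconv V"
proof
  fix x assume x: "x \<in> tconv W"
  show "x \<in> tconv V"
    unfolding mem_tconv_iff
  proof
    fix k
    obtain p l where p: "p \<in> W" "l \<noteq> \<infinity>" "\<And>i. l + hcoord p i \<le> hcoord x i"
      "l + hcoord p k = hcoord x k"
      using x unfolding mem_tconv_iff by meson
    obtain v m where v: "v \<in> V" "m \<noteq> \<infinity>" "\<And>i. m + hcoord v i \<le> hcoord p i"
      "m + hcoord v k = hcoord p k"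
      using p(1) assms unfolding mem_tconv_iff subset_iff by meson
    have "l + m + hcoord v i \<le> hcoord x i" for i
      using p(3)[of i] add_left_mono[OF v(3)[of i], of l] by (simp add: add.assoc)
    moreover have "l + m + hcoord v k = hcoord x k"
      using p(4) v(4) by (simp add: add.assoc)
    ultimately show "\<exists>v\<in>V. \<exists>l. l \<noteq> \<infinity> \<and> (\<forall>i. l + hcoord v i \<le> hcoord x i) \<and>
        l + hcoord v k = hcoord x k"
      using v(1,2) p(2) by (intro bexI[of _ v] exI[of _ "l + m"]) auto
  qed
qed

lemma tconv_subset_tspace:
  assumes "V \<subseteq> tspace" shows "tconv V \<subseteq> tspace"
proof
  fix x assume x: "x \<in> tconv V"
  have "x $ i \<noteq> \<infinity>" for i
  proof -
    obtain v l where "v \<in> V" "l \<noteq> \<infinity>" "l + hcoord v (Some i) = hcoord x (Some i)"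
      using x unfolding mem_tconv_iff by meson
    moreover from this have "hcoord v (Some i) \<noteq> \<infinity>"
      using assms hcoord_neq_PInf by blast
    ultimately show ?thesis by auto
  qed
  then show "x \<in> tspace" by (simp add: tspace_def trop_def)
qed

text \<open>Touching in \<open>None\<close> forces the scalar \<open>0\<close>, so \<open>v\<close>
  lies below \<open>x\<close>; touching elsewhere uses scalars at most \<open>0\<close>, so
  \<open>x\<close> lies below \<open>v\<close>.\<close>

lemma tconv_singleton: "tconv {v} = {v}"
proof -
  have "x = v" if x: "x \<in> tconv {v}" for x
  proof -
    have le: "hcoord v i \<le> hcoord x i" for i
      using x[unfolded mem_tconv_iff, rule_format, of None] by auto
    have "hcoord x k \<le> hcoord v k" for k
    proof -
      obtain l where "l + hcoord v None \<le> hcoord x None" "l + hcoord v k = hcoord x k"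
        using x[unfolded mem_tconv_iff, rule_format, of k] by blast
      then show ?thesis using add_right_mono[of l 0 "hcoord v k"] by simp
    qed
    then have "hcoord x (Some k) = hcoord v (Some k)" for k
      using le by (simp add: antisym del: hcoord_simps)
    then show ?thesis by (simp add: vec_eq_iff)
  qed
  then show ?thesis using subset_tconv[of "{v}"] by blast
qed

lemma tconv_empty: "tconv {} = {}"
  by (simp add: set_eq_iff mem_tconv_iff)

text \<open>Otherwise, expanding the elements of \<open>W\<close> in terms of \<open>V\<close> would
  express \<open>v\<close> through \<open>V - {v}\<close>, against minimality. Applied to a second
  minimal generating set as \<open>W\<close>, this yields uniqueness.\<close>

lemma min_generating_extreme:
  assumes min: "min_generating V P" and v: "v \<in> V" and W: "W \<subseteq> P" and vW: "v \<in> tconv W"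
  shows "v \<in> W"
proof (rule ccontr)
  assume "v \<notin> W"
  have VP: "tconv V = P" and Vt: "V \<subseteq> tspace" using min by (auto simp: min_generating_def)
  txt \<open>
    At a finite coordinate, \<open>v\<close> itself cannot be the touching generator, as this would force both
    scalars to be \<open>0\<close> and hence \<open>v = p \<in> W\<close>. At an infinite coordinate every multiple below \<open>v\<close>
    touches it, so the one found for \<open>None\<close> serves.
  \<close>
  have fin: "\<exists>u\<in>V - {v}. \<exists>l. l \<noteq> \<infinity> \<and> (\<forall>i. l + hcoord u i \<le> hcoord v i) \<and>
      l + hcoord u k = hcoord v k" if k: "hcoord v k \<noteq> -\<infinity>" for k
  proof -
    obtain p l where p: "p \<in> W" "l \<noteq> \<infinity>" "\<And>i. l + hcoord p i \<le> hcoord v i"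
      "l + hcoord p k = hcoord v k"
      using vW unfolding mem_tconv_iff by meson
    obtain u m where u: "u \<in> V" "m \<noteq> \<infinity>" "\<And>i. m + hcoord u i \<le> hcoord p i"
      "m + hcoord u k = hcoord p k"
      using p(1) W unfolding VP[symmetric] mem_tconv_iff subset_iff by meson
    have "u \<noteq> v"
    proof
      assume "u = v"
      have "hcoord v k \<noteq> \<infinity>" using Vt v hcoord_neq_PInf by blast
      then have "l + m = 0"
        using p(4) u(4) k p(2) u(2) \<open>u = v\<close>
        by (cases "hcoord v k"; cases l; cases m; cases "hcoord p k") auto
      moreover have "l \<le> 0" "m \<le> 0" using p(3)[of None] u(3)[of None] by auto
      ultimately have "l = 0" "m = 0"
        by (cases l; cases m; auto)+
      then have "hcoord v i = hcoord p i" for i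
        using p(3)[of i] u(3)[of i] \<open>u = v\<close> by (simp add: antisym)
      from this[of "Some _"] have "v = p" by (simp add: vec_eq_iff)
      then show False using \<open>v \<notin> W\<close> p(1) by simp
    qed
    moreover have "l + m + hcoord u i \<le> hcoord v i" for i
      using p(3)[of i] add_left_mono[OF u(3)[of i], of l] by (simp add: add.assoc)
    moreover have "l + m + hcoord u k = hcoord v k"
      using p(4) u(4) by (simp add: add.assoc)
    ultimately show ?thesis
      using u(1,2) p(2) by (intro bexI[of _ u] exI[of _ "l + m"]) auto
  qed
  have "v \<in> tconv (V - {v})"
    unfolding mem_tconv_iff
  proof
    fix k
    show "\<exists>u\<in>V - {v}. \<exists>l. l \<noteq> \<infinity> \<and> (\<forall>i. l + hcoord u i \<le> hcoord v i) \<and>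
      l + hcoord u k = hcoord v k"
    proof (cases "hcoord v k = -\<infinity>")
      case True
      have "hcoord v None \<noteq> -\<infinity>" by simp
      from fin[OF this] obtain u l where "u \<in> V - {v}" "l \<noteq> \<infinity>" "\<forall>i. l + hcoord u i \<le> hcoord v i"
        by blast
      then show ?thesis
        using True by (intro bexI[of _ u] exI[of _ l]) (auto dest: spec[of _ k])
    qed (rule fin)
  qed
  then have "V \<subseteq> tconv (V - {v})"
    using subset_tconv[of "V - {v}"] by blast
  then have "tconv (V - {v}) = P"
    using tconv_trans[of V "V - {v}"] tconv_mono[of "V - {v}" V] VP by auto
  then show False using min v by (auto simp: min_generating_def)
qed

lemma min_generating_unique:
  assumes "min_generating V P" "min_generating W P"
  shows "V = W"
proof -
  have "V \<subseteq> W" if "min_generating V P" "min_generating W P" for V W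
  proof -
    have "tconv W = P" "tconv V = P" using that by (auto simp: min_generating_def)
    then show ?thesis
      using min_generating_extreme[OF that(1)] subset_tconv by blast
  qed
  then show ?thesis using assms by blast
qed

text \<open>Gives meaning to the \<open>THE\<close> in \<open>tvertices\<close>: a finite generating
  set has a minimal generating subset, and uniqueness identifies it with the described set.\<close>

lemma tvertices_polytope:
  assumes "P \<in> trop_polytopes"
  shows "finite (tvertices P)" "tvertices P \<subseteq> tspace" "tconv (tvertices P) = P"
proof -
  obtain V0 where V0: "finite V0" "V0 \<subseteq> tspace" "tconv V0 = P"
    using assms by (auto simp: trop_polytopes_def)
  define S where "S = {V. V \<subseteq> V0 \<and> tconv V = P}"
  have "finite S" using V0 by (auto simp: S_def)
  moreover have "V0 \<in> S" using V0 by (simp add: S_def)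
  ultimately obtain V where V: "V \<in> S" "\<And>W. W \<in> S \<Longrightarrow> W \<subseteq> V \<Longrightarrow> W = V"
    using finite_has_minimal2[of S V0] by metis
  have "min_generating V P"
    unfolding min_generating_def
  proof (intro conjI allI impI notI)
    fix W assume "W \<subset> V" "tconv W = P"
    then have "W \<in> S" using V(1) by (auto simp: S_def)
    then show False using V(2) \<open>W \<subset> V\<close> by blast
  qed (use V V0 in \<open>auto simp: S_def\<close>)
  then have "tvertices P = V"
    unfolding tvertices_def by (rule the_equality) (rule min_generating_unique[OF _ \<open>min_generating V P\<close>])
  moreover have "V \<subseteq> V0" "tconv V = P" using V(1) by (simp_all add: S_def)
  ultimately show "finite (tvertices P)" "tvertices P \<subseteq> tspace" "tconv (tvertices P) = P"
    using V0 finite_subset[of V V0] by simp_all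
qed

subsection \<open>The covector decomposition\<close>

lemma Union_closed_cells:
  assumes "P \<in> trop_polytopes"
  shows "\<Union> (closed_cells P) = P"
proof
  note V = tvertices_polytope[OF assms]
  show "P \<subseteq> \<Union> (closed_cells P)"
  proof
    fix x assume x: "x \<in> P"
    have xV: "x \<in> tconv (tvertices P)" using x V(3) by simp
    then have xt: "x \<in> tspace" using tconv_subset_tspace[OF V(2)] by blast
    \<comment> \<open>The full covector of \<open>x\<close>: all pairs over the vertices whose
      inequalities hold at \<open>x\<close>. Touching generators supply a vertex for every
      coordinate.\<close>
    define G where "G = {(i, v). v \<in> tvertices P \<and>
      (\<forall>k. hcoord v k + hcoord x i \<le> hcoord v i + hcoord x k)}"
    have xG: "x \<in> covector_set G" using xt by (auto simp: covector_set_def G_def)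
    have "\<exists>v. (i, v) \<in> G" for i
    proof -
      obtain v l where v: "v \<in> tvertices P" "l \<noteq> \<infinity>" "\<And>k. l + hcoord v k \<le> hcoord x k"
        "l + hcoord v i = hcoord x i"
        by (rule tconvE[OF xV, where k = i]) iprover
      have "hcoord v k + hcoord x i \<le> hcoord v i + hcoord x k" for k
        using add_left_mono[OF v(3)[of k], of "hcoord v i"]
        by (simp add: v(4)[symmetric] ac_simps)
      then show ?thesis using v(1) by (auto simp: G_def)
    qed
    moreover have "\<exists>i. (i, v) \<in> G \<and> hcoord v i \<noteq> -\<infinity>" if v: "v \<in> tvertices P" for v
    proof -
      have vt: "hcoord v i \<noteq> \<infinity>" for i using V(2) v by (intro hcoord_neq_PInf) auto
      \<comment> \<open>Minimise \<open>x - v\<close> over the coordinates where \<open>v\<close> is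
        finite; \<open>None\<close> is always among them. Outside \<open>S\<close> the left-hand
        side of the required inequality is \<open>-\<infinity>\<close>.\<close>
      define S where "S = {i. hcoord v i \<noteq> -\<infinity>}"
      have "finite S" "S \<noteq> {}" by (auto simp: S_def intro: exI[of _ None])
      then obtain i where i: "i \<in> S" "\<And>k. k \<in> S \<Longrightarrow> hcoord x i - hcoord v i \<le> hcoord x k - hcoord v k"
        using ex_is_arg_min_if_finite[of S "\<lambda>i. hcoord x i - hcoord v i"]
        by (auto simp: is_arg_min_linorder)
      have "hcoord v k + hcoord x i \<le> hcoord v i + hcoord x k" for k
      proof (cases "k \<in> S")
        case True
        then show ?thesis
          using i(1) i(2)[OF True] vt[of i] vt[of k] hcoord_neq_PInf[OF xt, of i] hcoord_neq_PInf[OF xt, of k]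
          by (cases "hcoord v i"; cases "hcoord v k"; cases "hcoord x i"; cases "hcoord x k")
            (auto simp: S_def)
      qed (use hcoord_neq_PInf[OF xt, of i] in \<open>cases "hcoord x i"; auto simp: S_def\<close>)
      then show ?thesis using v i(1) by (auto simp: G_def S_def)
    qed
    ultimately have "covector_set G \<in> closed_cells P"
      using xG unfolding closed_cells_def by (auto simp: G_def intro!: exI[of _ G])
    then show "x \<in> \<Union> (closed_cells P)" using xG by blast
  qed
  show "\<Union> (closed_cells P) \<subseteq> P"
  proof
    fix x assume "x \<in> \<Union> (closed_cells P)"
    then obtain G where G: "x \<in> covector_set G" "G \<subseteq> UNIV \<times> tvertices P" "\<And>i. \<exists>v. (i, v) \<in> G"
      by (auto simp: closed_cells_def)
    have xt: "x \<in> tspace" using G(1) by (simp add: covector_set_def)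
    have fin: "\<exists>v\<in>tvertices P. \<exists>l. l \<noteq> \<infinity> \<and> (\<forall>i. l + hcoord v i \<le> hcoord x i) \<and>
      l + hcoord v k = hcoord x k" if k: "hcoord x k \<noteq> -\<infinity>" for k
    proof -
      obtain v where v: "(k, v) \<in> G" using G(3) by blast
      then have vV: "v \<in> tvertices P" using G(2) by blast
      have le: "hcoord v i + hcoord x k \<le> hcoord v k + hcoord x i" for i
        using G(1) v by (auto simp: covector_set_def)
      obtain r where r: "hcoord x k = ereal r"
        using k hcoord_neq_PInf[OF xt, of k] by (cases "hcoord x k") auto
      \<comment> \<open>The inequality at \<open>None\<close> reads
        \<open>hcoord x k \<le> hcoord v k\<close>, which rules out \<open>-\<infinity>\<close>. The
        difference \<open>r - s\<close> is then the scalar for which \<open>v\<close> touches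
        \<open>x\<close> at \<open>k\<close>.\<close>
      obtain s where s: "hcoord v k = ereal s"
        using le[of None] r hcoord_neq_PInf[of v k] V(2) vV by (cases "hcoord v k") auto
      have "ereal (r - s) + hcoord v i \<le> hcoord x i" for i
        using le[of i] hcoord_neq_PInf[OF xt, of i] r s
        by (cases "hcoord v i"; cases "hcoord x i") auto
      then show ?thesis
        using r s by (intro bexI[OF _ vV] exI[of _ "ereal (r - s)"]) auto
    qed
    have "x \<in> tconv (tvertices P)"
      unfolding mem_tconv_iff
    proof
      fix k
      show "\<exists>v\<in>tvertices P. \<exists>l. l \<noteq> \<infinity> \<and> (\<forall>i. l + hcoord v i \<le> hcoord x i) \<and>
        l + hcoord v k = hcoord x k"
      proof (cases "hcoord x k = -\<infinity>")
        case True
        \<comment> \<open>Any multiple lying below \<open>x\<close> touches it at an infinite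
          coordinate, so the one for \<open>None\<close> is reused.\<close>
        have "hcoord x None \<noteq> -\<infinity>" by simp
        from fin[OF this] obtain u l where "u \<in> tvertices P" "l \<noteq> \<infinity>" "\<forall>i. l + hcoord u i \<le> hcoord x i"
          by blast
        then show ?thesis
          using True by (intro bexI[of _ u] exI[of _ l]) (auto dest: spec[of _ k])
      qed (rule fin)
    qed
    then show "x \<in> P" using V by simp
  qed
qed

subsection \<open>Exponential coordinates\<close>

text \<open>For \<open>b > 1\<close> this is an order isomorphism from \<open>trop\<close> onto the
  nonnegative reals, taking addition to multiplication.\<close>

definition tev :: "real \<Rightarrow> ereal \<Rightarrow> real" where
  "tev b t = (if t = -\<infinity> then 0 else b powr real_of_ereal t)"

lemma texp_nth [simp]: "texp b x $ i = tev b (x $ i)"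
  by (simp add: texp_def tev_def)

text \<open>Counterpart of \<open>hcoord\<close> after exponentiation, so the homogenising
  coordinate \<open>0\<close> becomes \<open>1\<close>.\<close>

definition hreal :: "real ^ 'd::finite \<Rightarrow> 'd option \<Rightarrow> real" where
  "hreal y i = (case i of None \<Rightarrow> 1 | Some k \<Rightarrow> y $ k)"

lemma hreal_simps [simp]:
  "hreal y None = 1" "hreal y (Some k) = y $ k"
  by (simp_all add: hreal_def)

lemma continuous_on_hreal [continuous_intros]: "continuous_on S (\<lambda>y. hreal y i)"
  by (cases i) (auto intro!: continuous_intros)

lemma hreal_affine:
  "u + w = 1 \<Longrightarrow> hreal (u *\<^sub>R y + w *\<^sub>R z) i = u * hreal y i + w * hreal z i"
  by (cases i) auto

section \<open>Coordinate permutations with finite scaling\<close>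

lemma surj_scale_perm:
  fixes \<pi> :: "'d::finite \<Rightarrow> 'd" and z :: "ereal ^ 'd"
  assumes "bij \<pi>" "\<And>i. \<bar>z $ i\<bar> \<noteq> \<infinity>"
  shows "surj (\<lambda>x. \<chi> i. z $ i + x $ \<pi> i)"
proof (rule surjI)
  fix y :: "ereal ^ 'd"
  have "z $ i + (y $ i - z $ i) = y $ i" for i
    using assms(2)[of i] by (cases "z $ i"; cases "y $ i") auto
  then show "(\<chi> i. z $ i + (\<chi> k. y $ inv \<pi> k - z $ inv \<pi> k) $ \<pi> i) = y"
    using assms(1) by (simp add: vec_eq_iff bij_is_inj)
qed

text \<open>The map \<open>g\<close> moves coordinate \<open>k\<close> to \<open>inv \<pi> k\<close>
  and adds a finite constant there, which cancels in every inequality and equation of the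
  residuation criterion; \<open>None\<close> stays fixed.\<close>

lemma tconv_scale_perm:
  fixes \<pi> :: "'d::finite \<Rightarrow> 'd" and z :: "ereal ^ 'd"
  assumes \<pi>: "bij \<pi>" and z: "\<And>i. \<bar>z $ i\<bar> \<noteq> \<infinity>"
  defines "g \<equiv> \<lambda>x. \<chi> i. z $ i + x $ \<pi> i"
  shows "tconv (g ` V) = g ` tconv V"
proof -
  have le: "l + hcoord (g v) (map_option (inv \<pi>) k) \<le> hcoord (g x) (map_option (inv \<pi>) k) \<longleftrightarrow>
      l + hcoord v k \<le> hcoord x k" for l v x k
  proof (cases k)
    case (Some a)
    then show ?thesis
      using \<pi> z[of "inv \<pi> a"]
      by (auto simp: g_def bij_is_surj surj_f_inv_f add.left_commute[of l] ereal_add_le_add_iff)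
  qed simp
  have eq: "l + hcoord (g v) (map_option (inv \<pi>) k) = hcoord (g x) (map_option (inv \<pi>) k) \<longleftrightarrow>
      l + hcoord v k = hcoord x k" for l v x k
  proof (cases k)
    case (Some a)
    then show ?thesis
      using \<pi> z[of "inv \<pi> a"]
      by (auto simp: g_def bij_is_surj surj_f_inv_f add.left_commute[of l] ereal_add_cancel_left)
  qed simp
  have surj: "surj (map_option (inv \<pi>))"
    by (rule surjI[of _ "map_option \<pi>"]) (simp add: option.map_comp o_def \<pi> bij_is_inj option.map_ident)
  have mem: "y \<in> tconv W \<longleftrightarrow> (\<forall>k\<in>range (map_option (inv \<pi>)). \<exists>v\<in>W. \<exists>l. l \<noteq> \<infinity> \<and>
      (\<forall>i\<in>range (map_option (inv \<pi>)). l + hcoord v i \<le> hcoord y i) \<and> l + hcoord v k = hcoord y k)"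
    for y W unfolding surj by (simp add: mem_tconv_iff)
  have iff: "g x \<in> tconv (g ` V) \<longleftrightarrow> x \<in> tconv V" for x
    unfolding mem[of "g x"] mem_tconv_iff[of x] by (simp add: le eq)
  have "surj g" unfolding g_def using \<pi> z by (rule surj_scale_perm)
  show ?thesis
  proof (intro set_eqI iffI)
    fix y assume y: "y \<in> tconv (g ` V)"
    obtain x where "y = g x" using \<open>surj g\<close> by (rule surjE)
    then show "y \<in> g ` tconv V" using y iff by blast
  qed (use iff in blast)
qed

text \<open>Serves to show that the diagonal of a rotation is finite. Without summands
  \<open>\<infinity>\<close>, a single \<open>-\<infinity>\<close> absorbs the whole sum.\<close>

lemma sum_neq_MInfty_nth:
  fixes f :: "'a \<Rightarrow> ereal"
  assumes "finite A" "sum f A \<noteq> -\<infinity>" "\<And>i. i \<in> A \<Longrightarrow> f i \<noteq> \<infinity>" "i \<in> A"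
  shows "f i \<noteq> -\<infinity>"
proof -
  have "sum f A = f i + sum f (A - {i})" using assms by (simp add: sum.remove)
  moreover have "sum f (A - {i}) \<noteq> \<infinity>" using assms by (simp add: sum_Pinfty)
  ultimately show ?thesis using assms(2) by (cases "sum f (A - {i})") auto
qed

lemma trunk_subset: "P \<in> trop_polytopes \<Longrightarrow> trunk b P \<subseteq> P"
  using Union_closed_cells[of P] unfolding trunk_def by blast

lemma polytope_subset_tspace: "P \<in> trop_polytopes \<Longrightarrow> P \<subseteq> tspace"
  unfolding trop_polytopes_def using tconv_subset_tspace by blast

lemma trunk_subset_tspace: "P \<in> trop_polytopes \<Longrightarrow> trunk b P \<subseteq> tspace"
  using trunk_subset polytope_subset_tspace by blast

context
  fixes b :: real
  assumes b: "b > 1"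
begin

lemma tev_nonneg [simp]: "0 \<le> tev b t"
  by (simp add: tev_def)

lemma tev_0 [simp]: "tev b 0 = 1"
  using b by (simp add: tev_def)

lemma tev_add: "s \<noteq> \<infinity> \<Longrightarrow> t \<noteq> \<infinity> \<Longrightarrow> tev b (s + t) = tev b s * tev b t"
  by (cases s; cases t) (auto simp: tev_def powr_add)

lemma tev_le_iff: "s \<noteq> \<infinity> \<Longrightarrow> t \<noteq> \<infinity> \<Longrightarrow> tev b s \<le> tev b t \<longleftrightarrow> s \<le> t"
  using b by (cases s; cases t) (auto simp: tev_def not_le)

lemma tev_inject: "s \<noteq> \<infinity> \<Longrightarrow> t \<noteq> \<infinity> \<Longrightarrow> tev b s = tev b t \<longleftrightarrow> s = t"
  using tev_le_iff[of s t] tev_le_iff[of t s] by auto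

lemma tev_surj: "0 \<le> r \<Longrightarrow> \<exists>t. t \<noteq> \<infinity> \<and> tev b t = r"
  using b by (intro exI[of _ "if r = 0 then -\<infinity> else ereal (log b r)"]) (auto simp: tev_def)

lemma tev_sum: "finite A \<Longrightarrow> (\<And>i. i \<in> A \<Longrightarrow> f i \<noteq> \<infinity>) \<Longrightarrow> tev b (sum f A) = (\<Prod>i\<in>A. tev b (f i))"
  by (induction A rule: finite_induct) (simp_all add: tev_add sum_Pinfty)

lemma tev_hcoord: "tev b (hcoord x i) = hreal (texp b x) i"
  by (cases i) simp_all

lemma inj_on_texp: "inj_on (texp b) tspace"
  by (rule inj_onI) (simp add: vec_eq_iff tev_inject tspace_def trop_def)

lemma texp_surj:
  assumes "\<And>i. 0 \<le> y $ i" shows "\<exists>x\<in>tspace. texp b x = y"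
proof -
  obtain f where "\<And>i. f i \<noteq> \<infinity>" "\<And>i. tev b (f i) = y $ i"
    using tev_surj[OF assms] by metis
  then show ?thesis
    by (intro bexI[of _ "\<chi> i. f i"]) (simp_all add: vec_eq_iff tspace_def trop_def)
qed

text \<open>Exponentiation turns the tropical inequalities into non-strict affine-linear ones in
  \<open>y\<close>, so the images of cells are closed and convex.\<close>

lemma texp_covector_set:
  assumes "G \<subseteq> UNIV \<times> tspace"
  shows "texp b ` covector_set G = {y. (\<forall>i. 0 \<le> y $ i) \<and>
    (\<forall>(i, v)\<in>G. \<forall>k. tev b (hcoord v k) * hreal y i \<le> tev b (hcoord v i) * hreal y k)}" (is "_ = ?R")
proof -
  have iff: "x \<in> covector_set G \<longleftrightarrow> texp b x \<in> ?R" if x: "x \<in> tspace" for x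
  proof -
    have "hcoord v k + hcoord x i \<le> hcoord v i + hcoord x k \<longleftrightarrow>
      tev b (hcoord v k) * hreal (texp b x) i \<le> tev b (hcoord v i) * hreal (texp b x) k"
      if "(i, v) \<in> G" for i v k
    proof -
      have "v \<in> tspace" using that assms by auto
      then show ?thesis
        using x by (simp add: tev_hcoord[symmetric] tev_add[symmetric] tev_le_iff hcoord_neq_PInf)
    qed
    then show ?thesis using x unfolding covector_set_def by fastforce
  qed
  show ?thesis
  proof
    show "texp b ` covector_set G \<subseteq> ?R"
    proof
      fix y assume "y \<in> texp b ` covector_set G"
      then obtain x where x: "x \<in> covector_set G" "y = texp b x" by blast
      then have "x \<in> tspace" by (simp add: covector_set_def)
      from iff[OF this] show "y \<in> ?R" using x by simp
    qed
    show "?R \<subseteq> texp b ` covector_set G"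
    proof
      fix y assume y: "y \<in> ?R"
      then obtain x where "x \<in> tspace" "texp b x = y" using texp_surj[of y] by blast
      then show "y \<in> texp b ` covector_set G" using iff y by blast
    qed
  qed
qed

lemma closed_texp_covector_set:
  assumes "G \<subseteq> UNIV \<times> tspace"
  shows "closed (texp b ` covector_set G)"
proof -
  have "texp b ` covector_set G = (\<Inter>i. {y. 0 \<le> y $ i}) \<inter> (\<Inter>(i, v)\<in>G. \<Inter>k.
    {y. tev b (hcoord v k) * hreal y i \<le> tev b (hcoord v i) * hreal y k})"
    unfolding texp_covector_set[OF assms] by auto
  then show ?thesis
    by (auto intro!: closed_Int closed_INT closed_Collect_le continuous_intros)
qed

lemma convex_texp_covector_set:
  assumes "G \<subseteq> UNIV \<times> tspace"
  shows "convex (texp b ` covector_set G)"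
proof (rule convexI)
  fix y z and u w :: real
  assume y: "y \<in> texp b ` covector_set G" and z: "z \<in> texp b ` covector_set G"
    and u: "0 \<le> u" "0 \<le> w" "u + w = 1"
  note yz = y[unfolded texp_covector_set[OF assms]] z[unfolded texp_covector_set[OF assms]]
  have "tev b (hcoord v k) * hreal (u *\<^sub>R y + w *\<^sub>R z) i \<le> tev b (hcoord v i) * hreal (u *\<^sub>R y + w *\<^sub>R z) k"
    if "(i, v) \<in> G" for i v k
  proof -
    have "u * (tev b (hcoord v k) * hreal y i) + w * (tev b (hcoord v k) * hreal z i)
      \<le> u * (tev b (hcoord v i) * hreal y k) + w * (tev b (hcoord v i) * hreal z k)"
      using yz u that by (intro add_mono mult_left_mono) auto
    then show ?thesis using u by (simp add: hreal_affine algebra_simps)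
  qed
  moreover have "0 \<le> (u *\<^sub>R y + w *\<^sub>R z) $ i" for i
    using yz u by simp
  ultimately show "u *\<^sub>R y + w *\<^sub>R z \<in> texp b ` covector_set G"
    unfolding texp_covector_set[OF assms] by auto
qed

lemma texp_trunk:
  assumes "P \<in> trop_polytopes"
  shows "texp b ` trunk b P = closure (interior (texp b ` P))" "closed (texp b ` P)"
proof -
  note V = tvertices_polytope[OF assms]
  have cells: "closed (texp b ` C)" "convex (texp b ` C)" if C: "C \<in> closed_cells P" for C
  proof -
    obtain G where "C = covector_set G" "G \<subseteq> UNIV \<times> tvertices P"
      using C unfolding closed_cells_def by blast
    moreover from this have "G \<subseteq> UNIV \<times> tspace" using V(2) by blast
    ultimately show "closed (texp b ` C)" "convex (texp b ` C)"
      by (simp_all add: closed_texp_covector_set convex_texp_covector_set)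
  qed
  have "closed_cells P \<subseteq> covector_set ` Pow (UNIV \<times> tvertices P)"
    by (auto simp: closed_cells_def)
  then have fin: "finite (closed_cells P)"
    by (rule finite_subset) (simp add: V(1))
  have P: "texp b ` P = \<Union> ((`) (texp b) ` closed_cells P)"
    by (subst (1) Union_closed_cells[OF assms, symmetric]) auto
  show "closed (texp b ` P)"
    unfolding P using fin cells(1) by (intro closed_Union) auto
  have "closure (interior (texp b ` P)) = (\<Union>C\<in>closed_cells P. closure (interior (texp b ` C)))"
    unfolding P using fin cells(1) by (subst closure_interior_Union) auto
  also have "\<dots> = (\<Union>C\<in>closed_cells P. if aff_dim (texp b ` C) = int CARD('a) then texp b ` C else {})"
    using cells by (simp add: closure_interior_convex)
  also have "\<dots> = texp b ` trunk b P"
    by (auto simp: trunk_def split: if_splits)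
  finally show "texp b ` trunk b P = closure (interior (texp b ` P))" ..
qed

text \<open>Normalised scalars are at most \<open>0\<close>, so each coordinate of a point is
  bounded by that of some vertex. The sum over all vertices is a crude common bound.\<close>

lemma bounded_texp_polytope:
  assumes "P \<in> trop_polytopes"
  shows "bounded (texp b ` P)"
proof -
  note V = tvertices_polytope[OF assms]
  have "texp b x \<in> cbox 0 (\<chi> i. \<Sum>v\<in>tvertices P. tev b (v $ i))" if x: "x \<in> P" for x
  proof -
    have xt: "x \<in> tspace" using polytope_subset_tspace assms x by blast
    have "tev b (x $ i) \<le> (\<Sum>v\<in>tvertices P. tev b (v $ i))" for i
    proof -
      have "x \<in> tconv (tvertices P)" using x V(3) by simp
      then obtain v l where v: "v \<in> tvertices P" "\<And>k. l + hcoord v k \<le> hcoord x k"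
        "l + hcoord v (Some i) = hcoord x (Some i)"
        by (rule tconvE[where k = "Some i"]) iprover
      have vt: "v \<in> tspace" using v(1) V(2) by blast
      have "x $ i \<le> v $ i"
        using v(2)[of None] v(3) add_right_mono[of l 0 "v $ i"] by simp
      then have "tev b (x $ i) \<le> tev b (v $ i)"
        using xt vt by (simp add: tev_le_iff tspace_def trop_def)
      also have "\<dots> \<le> (\<Sum>v\<in>tvertices P. tev b (v $ i))"
        using V(1) v(1) by (intro member_le_sum) auto
      finally show ?thesis .
    qed
    then show ?thesis by (simp add: mem_box_cart)
  qed
  then show ?thesis
    using bounded_cbox bounded_subset by (metis image_subsetI)
qed

subsection \<open>The barycentric volume\<close>

text \<open>Justifies the \<open>GREATEST\<close> in \<open>tbvol\<close>. The product of the
  exponentiated coordinates is continuous even where some of them vanish, so infinite coordinates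
  need no separate treatment.\<close>

lemma tbvol_attained:
  assumes P: "P \<in> trop_polytopes" and ne: "trunk b P \<noteq> {}"
  obtains x where "x \<in> trunk b P" "\<And>y. y \<in> trunk b P \<Longrightarrow> (\<Sum>i\<in>UNIV. y $ i) \<le> (\<Sum>i\<in>UNIV. x $ i)"
    "tbvol b P = (\<Sum>i\<in>UNIV. x $ i)"
proof -
  have sum: "(\<Sum>i\<in>UNIV. y $ i) \<noteq> \<infinity>" "(\<Prod>i\<in>UNIV. texp b y $ i) = tev b (\<Sum>i\<in>UNIV. y $ i)"
    if "y \<in> trunk b P" for y
  proof -
    have "y \<in> tspace" using that trunk_subset_tspace[OF P] by blast
    then have "y $ i \<noteq> \<infinity>" for i by (simp add: tspace_def trop_def)
    then show "(\<Sum>i\<in>UNIV. y $ i) \<noteq> \<infinity>" "(\<Prod>i\<in>UNIV. texp b y $ i) = tev b (\<Sum>i\<in>UNIV. y $ i)"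
      by (simp_all add: sum_Pinfty tev_sum)
  qed
  have "compact (texp b ` trunk b P)"
    unfolding texp_trunk(1)[OF P] compact_closure
    using bounded_texp_polytope[OF P] interior_subset by (rule bounded_subset)
  moreover have "texp b ` trunk b P \<noteq> {}" using ne by simp
  moreover have "continuous_on (texp b ` trunk b P) (\<lambda>y. \<Prod>i\<in>UNIV. y $ i)"
    by (intro continuous_intros)
  ultimately have "\<exists>w\<in>texp b ` trunk b P. \<forall>y\<in>texp b ` trunk b P.
      (\<Prod>i\<in>UNIV. y $ i) \<le> (\<Prod>i\<in>UNIV. w $ i)"
    by (rule continuous_attains_sup)
  then obtain w where w: "w \<in> texp b ` trunk b P"
    "\<forall>y\<in>texp b ` trunk b P. (\<Prod>i\<in>UNIV. y $ i) \<le> (\<Prod>i\<in>UNIV. w $ i)"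
    by blast
  then obtain x where x: "x \<in> trunk b P" "w = texp b x" by blast
  have le: "(\<Sum>i\<in>UNIV. y $ i) \<le> (\<Sum>i\<in>UNIV. x $ i)" if y: "y \<in> trunk b P" for y
  proof -
    have "(\<Prod>i\<in>UNIV. texp b y $ i) \<le> (\<Prod>i\<in>UNIV. texp b x $ i)"
      using w(2) x(2) y by blast
    then show ?thesis
      unfolding sum(2)[OF y] sum(2)[OF x(1)] using tev_le_iff sum(1)[OF y] sum(1)[OF x(1)] by simp
  qed
  moreover have "tbvol b P = (\<Sum>i\<in>UNIV. x $ i)"
    unfolding tbvol_def using ne x(1) le by (auto intro!: Greatest_equality)
  ultimately show ?thesis using that x(1) by blast
qed

text \<open>The supremum also covers an empty trunk, since it is then
  \<open>-\<infinity>\<close>.\<close>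

lemma tbvol_eq_SUP:
  assumes "P \<in> trop_polytopes"
  shows "tbvol b P = (SUP x\<in>trunk b P. \<Sum>i\<in>UNIV. x $ i)"
proof (cases "trunk b P = {}")
  case True
  then show ?thesis by (simp add: tbvol_def bot_ereal_def)
next
  case False
  then obtain x where "x \<in> trunk b P" "\<And>y. y \<in> trunk b P \<Longrightarrow> (\<Sum>i\<in>UNIV. y $ i) \<le> (\<Sum>i\<in>UNIV. x $ i)"
    "tbvol b P = (\<Sum>i\<in>UNIV. x $ i)" using tbvol_attained assms by blast
  then show ?thesis by (auto intro!: antisym SUP_upper SUP_least)
qed

lemma tbvol_neq_PInf:
  assumes "P \<in> trop_polytopes" shows "tbvol b P \<noteq> \<infinity>"
proof (cases "trunk b P = {}")
  case False
  then obtain x where "x \<in> trunk b P" "tbvol b P = (\<Sum>i\<in>UNIV. x $ i)"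
    using tbvol_attained assms by blast
  then show ?thesis
    using trunk_subset_tspace[OF assms] by (auto simp: sum_Pinfty tspace_def trop_def)
qed (simp add: tbvol_def)

section \<open>Inclusions, unions and linear images\<close>

lemma trunk_mono:
  assumes "P \<in> trop_polytopes" "Q \<in> trop_polytopes" "P \<subseteq> Q"
  shows "trunk b P \<subseteq> trunk b Q"
proof -
  have "texp b ` trunk b P \<subseteq> texp b ` trunk b Q"
    using assms by (simp add: texp_trunk closure_mono interior_mono image_mono)
  then show ?thesis
    using inj_on_image_subset_iff[OF inj_on_texp] trunk_subset_tspace assms by metis
qed

text \<open>The images of both polytopes are closed, so \<open>closure_interior_Un\<close> applies;
  injectivity of \<open>texp b\<close> on \<open>tspace\<close> carries the equality back to the
  trunks.\<close>

lemma trunk_Un: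
  assumes "P \<in> trop_polytopes" "Q \<in> trop_polytopes" "P \<union> Q \<in> trop_polytopes"
  shows "trunk b (P \<union> Q) = trunk b P \<union> trunk b Q"
proof -
  have "texp b ` trunk b (P \<union> Q) = texp b ` (trunk b P \<union> trunk b Q)"
    using assms by (simp add: texp_trunk image_Un closure_interior_Un)
  then show ?thesis
    using inj_on_image_eq_iff[OF inj_on_texp] trunk_subset_tspace assms by (metis Un_least)
qed

lemma tbvol_mono:
  assumes "P \<in> trop_polytopes" "Q \<in> trop_polytopes" "P \<subseteq> Q"
  shows "tbvol b P \<le> tbvol b Q"
  using assms by (simp add: tbvol_eq_SUP SUP_subset_mono trunk_mono)

lemma tbvol_Un:
  assumes "P \<in> trop_polytopes" "Q \<in> trop_polytopes" "P \<union> Q \<in> trop_polytopes"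
  shows "tbvol b (P \<union> Q) = max (tbvol b P) (tbvol b Q)"
  using assms by (simp add: tbvol_eq_SUP trunk_Un SUP_union sup_max)

text \<open>Handles rotations (entries of \<open>z\<close> summing to \<open>0\<close>) and finite
  scalings (\<open>\<pi>\<close> the identity) at once. In exponential coordinates \<open>g\<close>
  becomes the injective linear map \<open>f\<close>, which commutes with interior and closure, so
  the trunk is mapped to the trunk.\<close>

lemma tbvol_scale_perm:
  fixes \<pi> :: "'d::finite \<Rightarrow> 'd" and z :: "ereal ^ 'd"
  assumes \<pi>: "bij \<pi>" and z: "\<And>i. \<bar>z $ i\<bar> \<noteq> \<infinity>" and P: "P \<in> trop_polytopes"
  shows "tbvol b ((\<lambda>x. \<chi> i. z $ i + x $ \<pi> i) ` P) = (\<Sum>i\<in>UNIV. z $ i) + tbvol b P"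
proof -
  define g where "g = (\<lambda>x. \<chi> i. z $ i + x $ \<pi> i)"
  define f where "f = (\<lambda>y::real^'d. \<chi> i. tev b (z $ i) * y $ \<pi> i)"
  have zf: "z $ i \<noteq> \<infinity>" "z $ i \<noteq> -\<infinity>" for i using z[of i] by auto
  have pos: "tev b (z $ i) \<noteq> 0" for i using zf b by (simp add: tev_def)
  have gt: "g ` A \<subseteq> tspace" if "A \<subseteq> tspace" for A
    using that zf by (auto simp: g_def tspace_def trop_def)
  have gP: "g ` P \<in> trop_polytopes"
  proof -
    obtain V where "finite V" "V \<subseteq> tspace" "P = tconv V" using P by (auto simp: trop_polytopes_def)
    then show ?thesis
      using tconv_scale_perm[OF \<pi> z, of V, folded g_def] gt[of V]
      by (auto simp: trop_polytopes_def)
  qed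
  have fg: "texp b (g x) = f (texp b x)" if "x \<in> tspace" for x
    using that zf by (simp add: vec_eq_iff f_def g_def tev_add tspace_def trop_def)
  then have fgA: "texp b ` g ` A = f ` texp b ` A" if "A \<subseteq> tspace" for A
    using that by (force simp: image_image)
  have lin: "linear f"
    by (rule linearI) (simp_all add: f_def vec_eq_iff algebra_simps)
  have inj: "inj f"
  proof (rule injI)
    fix y y' assume "f y = f y'"
    then have "y $ \<pi> i = y' $ \<pi> i" for i using pos by (simp add: f_def vec_eq_iff)
    then show "y = y'" using \<pi> by (metis bij_pointE vec_eq_iff)
  qed
  have "texp b ` trunk b (g ` P) = closure (interior (f ` texp b ` P))"
    using gP P by (simp add: texp_trunk fgA polytope_subset_tspace)
  also have "\<dots> = f ` texp b ` trunk b P"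
    using P by (simp add: interior_injective_linear_image[OF lin inj]
        closure_injective_linear_image[OF lin inj] texp_trunk)
  also have "\<dots> = texp b ` g ` trunk b P"
    using P by (simp add: fgA trunk_subset_tspace)
  finally have tr: "trunk b (g ` P) = g ` trunk b P"
    using inj_on_image_eq_iff[OF inj_on_texp trunk_subset_tspace[OF gP] gt[OF trunk_subset_tspace[OF P]]]
    by blast
  have sum_g: "(\<Sum>i\<in>UNIV. g x $ i) = (\<Sum>i\<in>UNIV. z $ i) + (\<Sum>i\<in>UNIV. x $ i)" for x
    using sum.reindex_bij_betw[OF \<pi>, of "\<lambda>i. x $ i"] by (simp add: g_def sum.distrib)
  have zs: "\<bar>\<Sum>i\<in>UNIV. z $ i\<bar> \<noteq> \<infinity>"
    using z by (simp add: sum_Inf)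
  have "tbvol b (g ` P) = (\<Sum>i\<in>UNIV. z $ i) + tbvol b P"
  proof (cases "trunk b P = {}")
    case True
    then show ?thesis using tr zs by (auto simp: tbvol_def)
  next
    case False
    show ?thesis
      unfolding tbvol_eq_SUP[OF P] tbvol_eq_SUP[OF gP] tr
      unfolding image_image sum_g
      using False zs by (intro SUP_ereal_add_right) auto
  qed
  then show ?thesis by (simp add: g_def)
qed

text \<open>A nonempty trunk means nonempty interior in exponential coordinates. An interior point
  of a subset of the orthant has positive coordinates, so it comes from a trunk point with finite
  coordinate sum.\<close>

lemma tbvol_eq_MInf_iff:
  assumes P: "P \<in> trop_polytopes"
  shows "tbvol b P = -\<infinity> \<longleftrightarrow> trunk b P = {}"
proof (cases "trunk b P = {}")
  case True
  then show ?thesis by (simp add: tbvol_def)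
next
  case False
  then have "interior (texp b ` P) \<noteq> {}"
    using texp_trunk(1)[OF P] by auto
  then obtain y where y: "y \<in> interior (texp b ` P)" by blast
  then obtain x where x: "x \<in> trunk b P" "y = texp b x"
    using texp_trunk(1)[OF P] closure_subset by blast
  have xt: "x \<in> tspace" using x(1) trunk_subset_tspace[OF P] by blast
  have "x $ i \<noteq> -\<infinity>" for i
  proof -
    have "texp b ` P \<subseteq> {y. 0 \<le> y $ i}" by auto
    then have "y \<in> interior {y. 0 \<le> y $ i}" using y interior_mono by blast
    then have "0 < y $ i" using interior_halfspace_component_ge[of 0 i] by simp
    then show ?thesis using x(2) by (auto simp: tev_def)
  qed
  then have "(\<Sum>i\<in>UNIV. x $ i) \<noteq> -\<infinity>"
    using xt sum_Inf[of "\<lambda>i. x $ i" UNIV] by (auto simp: tspace_def trop_def)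
  moreover have "(\<Sum>i\<in>UNIV. x $ i) \<le> tbvol b P"
    unfolding tbvol_eq_SUP[OF P] using x(1) by (rule SUP_upper)
  ultimately show ?thesis using False by auto
qed

lemma tbvol_empty: "tbvol b ({} :: (ereal ^ 'd::finite) set) = -\<infinity>"
proof -
  have "({} :: (ereal ^ 'd::finite) set) \<in> trop_polytopes"
    using tconv_empty by (auto simp: trop_polytopes_def)
  from trunk_subset[OF this, of b] show ?thesis by (simp add: tbvol_def)
qed

lemma tbvol_singleton:
  fixes v :: "ereal ^ 'd::finite"
  assumes "v \<in> tspace"
  shows "tbvol b {v} = -\<infinity>"
proof -
  have P: "{v} \<in> trop_polytopes"
    using assms tconv_singleton[of v] by (auto simp: trop_polytopes_def intro!: exI[of _ "{v}"])
  have "texp b ` trunk b {v} = {}"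
    unfolding texp_trunk(1)[OF P] by simp
  then show ?thesis by (simp add: tbvol_def)
qed

end

section \<open>Tropical powers and rotation matrices\<close>

lemma tpow_CARD: "tpow l CARD('d::finite) = (\<Sum>i\<in>(UNIV::'d set). l)"
proof -
  have "(\<Sum>i\<in>A. l) = tpow l (card A)" if "finite A" for A :: "'d set"
    using that by (induction A rule: finite_induct) (simp_all add: tpow_def)
  then show ?thesis by simp
qed

text \<open>Row \<open>i\<close> of a rotation has one finite entry, \<open>z $ i\<close> in column
  \<open>\<pi> i\<close>. On \<open>tspace\<close> the other terms of the product are
  \<open>-\<infinity>\<close>; a coordinate \<open>\<infinity>\<close> would spoil this, as
  \<open>-\<infinity> + \<infinity> = \<infinity>\<close> in \<open>ereal\<close>.\<close>

lemma trop_rotations_vec: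
  fixes M :: "ereal ^ 'd::finite ^ 'd"
  assumes "M \<in> trop_rotations"
  obtains z :: "ereal ^ 'd" and \<pi> where "bij \<pi>" "\<And>i. \<bar>z $ i\<bar> \<noteq> \<infinity>" "(\<Sum>i\<in>UNIV. z $ i) = 0"
    "\<And>x. x \<in> tspace \<Longrightarrow> tmat_vec M x = (\<chi> i. z $ i + x $ \<pi> i)"
proof -
  obtain z :: "ereal ^ 'd" and \<pi> where M: "M = tmat_mult (tdiag z) (tperm \<pi>)" "z \<in> tspace"
    "(\<Sum>i\<in>UNIV. z $ i) = 0" "bij \<pi>"
    using assms by (auto simp: trop_rotations_def)
  have z: "z $ i \<noteq> \<infinity>" "z $ i \<noteq> -\<infinity>" for i
    using M(2) sum_neq_MInfty_nth[of UNIV "\<lambda>i. z $ i" i] M(3) by (auto simp: tspace_def trop_def)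
  have single: "(SUP k. if k = j then s else -\<infinity>) = s" for j :: 'd and s :: ereal
    by (rule antisym) (auto intro!: SUP_least SUP_upper2[of j])
  have "M $ i $ j = (SUP k. if k = i then (if j = \<pi> i then z $ i else -\<infinity>) else -\<infinity>)" for i j
    unfolding M(1) tmat_mult_def tdiag_def tperm_def
    by (simp only: vec_lambda_beta, rule SUP_cong) (use z in auto)
  then have Mij: "M $ i $ j = (if j = \<pi> i then z $ i else -\<infinity>)" for i j
    by (simp only: single)
  have "tmat_vec M x = (\<chi> i. z $ i + x $ \<pi> i)" if x: "x \<in> tspace" for x
  proof -
    have "(SUP k. M $ i $ k + x $ k) = (SUP k. if k = \<pi> i then z $ i + x $ \<pi> i else -\<infinity>)" for i
      unfolding Mij using x by (intro SUP_cong) (auto simp: tspace_def trop_def)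
    then show ?thesis unfolding tmat_vec_def by (simp only: single)
  qed
  then show ?thesis using M(3,4) z by (intro that[of \<pi> z]) auto
qed

theorem proposition4p8:
  fixes b :: real
  assumes "b > 1"
  shows
    "(\<forall>P \<in> (trop_polytopes :: (ereal ^ 'd::finite) set set). \<forall>Q \<in> trop_polytopes.
        P \<subseteq> Q \<longrightarrow> tbvol b P \<le> tbvol b Q) \<and>
     (\<forall>P \<in> (trop_polytopes :: (ereal ^ 'd) set set). \<forall>Q \<in> trop_polytopes.
        P \<union> Q \<in> trop_polytopes \<and> P \<inter> Q \<in> trop_polytopes \<longrightarrow>
        max (tbvol b P) (tbvol b Q) = max (tbvol b (P \<union> Q)) (tbvol b (P \<inter> Q))) \<and>
     (\<forall>M \<in> (trop_rotations :: (ereal ^ 'd ^ 'd) set). \<forall>P \<in> trop_polytopes.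
        tbvol b (tmat_vec M ` P) = tbvol b P) \<and>
     (\<forall>l \<in> trop. \<forall>P \<in> (trop_polytopes :: (ereal ^ 'd) set set).
        tbvol b (tscale l ` P) = tpow l CARD('d) + tbvol b P) \<and>
     (\<forall>P \<in> (trop_polytopes :: (ereal ^ 'd) set set).
        tbvol b P = -\<infinity> \<longleftrightarrow> trunk b P = {})"
proof (intro conjI ballI impI, goal_cases)
  case (1 P Q)
  then show ?case by (intro tbvol_mono[OF assms])
next
  case (2 P Q)
  \<comment> \<open>The union alone already has the maximum of both volumes, and monotonicity lets
    it absorb the intersection.\<close>
  then have "tbvol b (P \<inter> Q) \<le> tbvol b P" by (intro tbvol_mono[OF assms]) auto
  then show ?case using 2 by (simp add: tbvol_Un[OF assms] max.coboundedI1 max_absorb1)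
next
  case (3 M P)
  obtain z :: "ereal ^ 'd" and \<pi> where z: "bij \<pi>" "\<And>i. \<bar>z $ i\<bar> \<noteq> \<infinity>" "(\<Sum>i\<in>UNIV. z $ i) = 0"
    "\<And>x. x \<in> tspace \<Longrightarrow> tmat_vec M x = (\<chi> i. z $ i + x $ \<pi> i)"
    using 3(1) by (rule trop_rotations_vec) iprover
  have "tmat_vec M ` P = (\<lambda>x. \<chi> i. z $ i + x $ \<pi> i) ` P"
    using z(4) polytope_subset_tspace[OF 3(2)] by (intro image_cong) auto
  then show ?case using tbvol_scale_perm[OF assms z(1,2) 3(2)] z(3) by simp
next
  case (4 l P)
  show ?case
  \<comment> \<open>Scaling by \<open>-\<infinity>\<close> is not invertible: it collapses a
    nonempty \<open>P\<close> to one point, whose trunk is empty.\<close>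
  proof (cases "l = -\<infinity>")
    case True
    have "tpow (-\<infinity>) (Suc n) = -\<infinity>" for n
      by (induction n) (simp_all add: tpow_def)
    \<comment> \<open>Positivity of the dimension matters here, because
      \<open>tpow l 0 = 0\<close>.\<close>
    then have "tpow l CARD('d) = -\<infinity>"
      using True by (cases "CARD('d)") simp_all
    moreover have "tbvol b (tscale l ` P) = -\<infinity>"
    proof (cases "P = {}")
      case True
      then show ?thesis by (simp add: tbvol_empty[OF assms])
    next
      case False
      have "tscale l x = (\<chi> i. -\<infinity>)" if "x \<in> P" for x
        using that True polytope_subset_tspace[OF 4(2)]
        by (auto simp: tscale_def tspace_def trop_def vec_eq_iff)
      then have "tscale l ` P = {\<chi> i. -\<infinity>}" using False by auto
      then show ?thesis by (simp add: tbvol_singleton[OF assms] tspace_def trop_def)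
    qed
    ultimately show ?thesis using tbvol_neq_PInf[OF assms 4(2)] by simp
  next
    case False
    then have l: "\<bar>l\<bar> \<noteq> \<infinity>" using 4(1) by (cases l) (auto simp: trop_def)
    have "tscale l = (\<lambda>x :: ereal ^ 'd. \<chi> i. (\<chi> _. l) $ i + x $ id i)"
      by (simp add: tscale_def fun_eq_iff)
    then show ?thesis
      using tbvol_scale_perm[OF assms bij_id, of "\<chi> _. l" P] 4(2) l
      by (simp add: tpow_CARD)
  qed
next
  case (5 P)
  then show ?case by (intro tbvol_eq_MInf_iff[OF assms])
qed

end
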